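(* Let $n\ge 1$ be an integer and define $$S(k,l,n)=\sum_{\mathbf p}\frac{e_k(p_1,\ldots,p_l)}{L(\mathbf p)\,R(\mathbf p)},$$ the sum taken over all $l$-compositions $\mathbf p=(p_1,\ldots,p_l)$ of $n$, where $L(\mathbf p)=p_1(p_1+p_2)\cdots(p_1+\cdots+p_{l-1})\,n$ and $R(\mathbf p)=p_l(p_{l-1}+p_l)\cdots(p_2+\cdots+p_l)\,n$. Let $$P_n(u,v)=\sum_{l=1}^{n}\sum_{k=0}^{l} S(k,l,n)\,u^k v^{l-k}.$$ Put $q_i=i(n-i)$ and $r_i=(n-1-2i)^2$. If $n=2m$ is even, then $$(n!)^2P_n(u,v)=\prod_{i=0}^{m-1}\bigl[(u+v+q_i)(u+v+q_{i+1})+r_iu\bigr].$$ If $n=2m+1$ is odd, then $$(n!)^2P_n(u,v)=(u+v+q_m)\prod_{i=0}^{m-1}\bigl[(u+v+q_i)(u+v+q_{i+1})+r_iu\bigr].$$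
   Context: An $l$-composition of a positive integer $n$ is an ordered list $(p_1,\ldots,p_l)$ of positive integers with $p_1+\cdots+p_l=n$. $e_j(x_1,\ldots,x_k)$ denotes the $j$-th elementary symmetric function, i.e. the coefficient of $X^{k-j}$ in $(X+x_1)\cdots(X+x_k)$; in particular $e_0=1$. For $l=1$ the products $L(\mathbf p)$ and $R(\mathbf p)$ both equal $n$. $u,v$ are indeterminates. *)

theory Defs
  imports "HOL-Computational_Algebra.Polynomial"
begin

(* The guard matters: for j > length xs the truncated subtraction would give the constant
   coefficient, whereas e_j of fewer than j variables is 0. *)
definition elem_sym :: "nat \<Rightarrow> 'a::comm_semiring_1 list \<Rightarrow> 'a" where
  "elem_sym j xs =
     (if j \<le> length xs then coeff (\<Prod>x\<leftarrow>xs. [:x, 1:]) (length xs - j) else 0)"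

definition compositions :: "nat \<Rightarrow> nat \<Rightarrow> nat list set" where
  "compositions l n = {p. length p = l \<and> (\<forall>x\<in>set p. 0 < x) \<and> sum_list p = n}"

lemma finite_compositions: "finite (compositions l n)"
proof (rule finite_subset)
  show "compositions l n \<subseteq> {p. set p \<subseteq> {..n} \<and> length p = l}"
    unfolding compositions_def using member_le_sum_list by fastforce
  show "finite {p. set p \<subseteq> {..n} \<and> length p = l}"
    by (rule finite_lists_length_eq) simp
qed

definition prefix_prod :: "nat list \<Rightarrow> nat" where
  "prefix_prod p = (\<Prod>i=1..<length p. sum_list (take i p)) * sum_list p"

definition suffix_prod :: "nat list \<Rightarrow> nat" where
  "suffix_prod p = (\<Prod>i=1..<length p. sum_list (drop i p)) * sum_list p"

definition S_coeff :: "nat \<Rightarrow> nat \<Rightarrow> nat \<Rightarrow> rat" where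
  "S_coeff k l n = (\<Sum>p\<in>compositions l n.
     elem_sym k (map of_nat p) / (of_nat (prefix_prod p) * of_nat (suffix_prod p)))"

(* Polynomials in the two indeterminates u and v are modelled as Q[v][u]: the outer variable
   is u, the inner one is v, and a rational c is embedded as [:[:c:]:]. *)
definition U :: "rat poly poly" where "U = [:0, 1:]"
definition V :: "rat poly poly" where "V = [:[:0, 1:]:]"

definition P_poly :: "nat \<Rightarrow> rat poly poly" where
  "P_poly n = (\<Sum>l=1..n. \<Sum>k=0..l. [:[:S_coeff k l n:]:] * U ^ k * V ^ (l - k))"

definition q_num :: "nat \<Rightarrow> nat \<Rightarrow> int" where
  "q_num n i = int i * (int n - int i)"

definition r_num :: "nat \<Rightarrow> nat \<Rightarrow> int" where
  "r_num n i = (int n - 1 - 2 * int i)\<^sup>2"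

end

(* A composition p of n is the set of its proper partial sums, and L(p) R(p) is n^2 times the
   product of q_s over these sums s.  As sum_k e_k(p) u^k v^(l-k) = prod (v + u p_i), n^2 P_n = f_n
   where f_0 = w_0 = 1, w_i = 1/q_i and f_j = sum_{i<j} (v + u (j - i)) w_i f_i for j > 0.
   The series G = sum_{j<n} w_j f_j x^j + ... then satisfies, up to order x^n, the Fuchsian equation
     (1-x)^2 theta(n - theta) G = ((u + v) x - v x^2) G,   theta = x d/dx,
   which for u = a (1 - a) is solved by (1-x)^a times a truncated hypergeometric series.  Since 0 and
   n are its exponents at x = 0, f_n is the obstruction to continuing the solution past x^n;
   it equals prod_{i<n} (v + (a + i)(n - a - i)) / ((n-1)!)^2.  Multiplying the factors for i and
   n - 1 - i gives an expression in u = a (1 - a) alone.  Infinitely many values u = a (1 - a)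
   with a rational suffice to identify the polynomials. *)
theory Submission
  imports Defs "HOL-Computational_Algebra.Formal_Power_Series"
begin

unbundle fps_syntax

section \<open>Coefficients of Euler-type operators and division by 1 - x\<close>

lemma fps_X_mult_deriv_nth: "(fps_X * fps_deriv F) $ k = of_nat k * F $ k"
  by (cases k) simp_all

lemma fps_X2_mult_deriv2_nth:
  fixes F :: "'a::comm_ring_1 fps"
  shows "(fps_X^2 * fps_deriv (fps_deriv F)) $ k = of_nat k * (of_nat k - 1) * F $ k"
proof (cases "k < 2")
  case True
  then have "k = 0 \<or> k = 1" by auto
  then show ?thesis by auto
next
  case False
  then obtain j where "k = Suc (Suc j)"
    by (metis add_2_eq_Suc le_iff_add not_less)
  then show ?thesis
    by (simp add: fps_X_power_mult_nth)
qed

text \<open>\<open>1 - fps_X\<close> is a unit with constant term 1, so dividing by it keeps both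
  the order of vanishing at 0 and the first coefficient.\<close>

lemma fps_nth_below_cancel_one_minus_X:
  fixes Y Z :: "'a::field fps"
  assumes "(1 - fps_X) * Y = Z * fps_X ^ n"
  shows "j < n \<Longrightarrow> Y $ j = 0" and "Y $ n = Z $ 0"
proof -
  have "inverse (1 - fps_X) * (1 - fps_X) = (1 :: 'a fps)"
    by (rule inverse_mult_eq_1) simp
  then have "Y = inverse (1 - fps_X) * ((1 - fps_X) * Y)"
    by (simp flip: mult.assoc)
  also have "\<dots> = fps_X ^ n * (inverse (1 - fps_X) * Z)"
    unfolding assms by (simp add: mult_ac)
  finally have Y: "Y = fps_X ^ n * (inverse (1 - fps_X) * Z)" .
  show "j < n \<Longrightarrow> Y $ j = 0"
    by (subst Y) (simp add: fps_X_power_mult_nth)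
  show "Y $ n = Z $ 0"
    by (subst Y) (simp add: fps_X_power_mult_nth)
qed

section \<open>The binomial and truncated hypergeometric series\<close>

text \<open>The binomial series of (1 - x)^a; the rising factorial of \<open>- a\<close> absorbs the
  alternating sign.\<close>

definition fps_one_minus_X_powr :: "'a::field_char_0 \<Rightarrow> 'a fps" where
  "fps_one_minus_X_powr a = Abs_fps (\<lambda>k. pochhammer (- a) k / fact k)"

lemma fps_deriv_one_minus_X_powr:
  "(1 - fps_X) * fps_deriv (fps_one_minus_X_powr a) = - fps_const a * fps_one_minus_X_powr a"
proof (rule fps_ext)
  fix k
  show "((1 - fps_X) * fps_deriv (fps_one_minus_X_powr a)) $ k =
    (- fps_const a * fps_one_minus_X_powr a) $ k"
    unfolding left_diff_distrib mult_1 fps_sub_nth fps_X_mult_deriv_nth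
    by (simp add: fps_one_minus_X_powr_def pochhammer_Suc field_simps del: of_nat_Suc)
qed

definition hyp_factor :: "'a::field_char_0 \<Rightarrow> 'a \<Rightarrow> nat \<Rightarrow> nat \<Rightarrow> 'a" where
  "hyp_factor a v n i = v + (a + of_nat i) * (of_nat n - a - of_nat i)"

text \<open>Coefficients of the Gauss series 2F1(alpha, beta; 1 - n; x) with alpha + beta = 2 a - n
  and alpha beta = a^2 - n a - v. Only these symmetric functions enter, so the quadratic need not
  split over the field.\<close>

definition hyp_coeff :: "'a::field_char_0 \<Rightarrow> 'a \<Rightarrow> nat \<Rightarrow> nat \<Rightarrow> 'a" where
  "hyp_coeff a v n k =
     (\<Prod>i<k. hyp_factor a v n i / (of_nat (Suc i) * (of_nat n - of_nat (Suc i))))"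

lemma hyp_coeff_Suc:
  assumes "Suc k < n"
  shows "of_nat (Suc k) * (of_nat n - of_nat (Suc k)) * hyp_coeff a v n (Suc k) =
    hyp_factor a v n k * hyp_coeff a v n k"
proof -
  have "of_nat n \<noteq> (of_nat (Suc k) :: 'a)" "of_nat (Suc k) \<noteq> (0::'a)"
    using assms by (simp_all only: of_nat_eq_iff of_nat_eq_0_iff)
  then show ?thesis
    by (simp add: hyp_coeff_def del: of_nat_Suc)
qed

text \<open>The lower parameter 1 - n gives a zero denominator at the coefficient \<open>n\<close>,
  hence the truncation.\<close>

definition hyp_fps :: "'a::field_char_0 \<Rightarrow> 'a \<Rightarrow> nat \<Rightarrow> 'a fps" where
  "hyp_fps a v n = Abs_fps (\<lambda>k. if k < n then hyp_coeff a v n k else 0)"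

text \<open>The right-hand side is the defect caused by truncating the series before \<open>x ^ n\<close>.\<close>
lemma hyp_fps_ode:
  fixes a v :: "'a::field_char_0"
  assumes "n \<ge> 1"
  defines "H \<equiv> hyp_fps a v n"
  shows "fps_const (of_nat n - 1) * (fps_X * fps_deriv H) - fps_X^2 * fps_deriv (fps_deriv H)
      + fps_X * (fps_const (1 + 2 * a - of_nat n) * (fps_X * fps_deriv H)
         + fps_X^2 * fps_deriv (fps_deriv H) + fps_const (a^2 - of_nat n * a - v) * H)
    = fps_const (- hyp_factor a v n (n - 1) * hyp_coeff a v n (n - 1)) * fps_X ^ n"
    (is "?L = ?R")
proof (rule fps_ext)
  fix k
  show "?L $ k = ?R $ k"
  proof (cases k)
    case 0
    then show ?thesis using assms(1) by (simp)
  next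
    case (Suc j)
    have "?L $ k = of_nat (Suc j) * (of_nat n - of_nat (Suc j)) * H $ Suc j
       - hyp_factor a v n j * H $ j"
      by (simp add: Suc fps_X_mult_deriv_nth fps_X2_mult_deriv2_nth 
          del: fps_mult_fps_X_deriv_shift fps_X_power_mult_nth)
        (simp add: hyp_factor_def power2_eq_square algebra_simps)
    also have "\<dots> = ?R $ k"
    proof (cases "Suc j < n")
      case True
      then show ?thesis
        using hyp_coeff_Suc[OF True, of a v] 
        by (simp add: H_def hyp_fps_def Suc del: of_nat_Suc)
    next
      case False
      then show ?thesis using assms(1)
        by (cases "Suc j = n") (auto simp: H_def hyp_fps_def Suc)
    qed
    finally show ?thesis .
  qed
qed

section \<open>From the Fuchsian equation to the recurrence\<close>

text \<open>The Fuchsian equation divided by (1 - x)^2 and read off coefficientwise. Below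
  \<open>n\<close> it holds exactly; at \<open>n\<close> its left side vanishes, and the sum on the
  right equals the truncation defect up to sign.\<close>

lemma hyp_recurrence:
  fixes a v :: "'a::field_char_0"
  assumes n: "n \<ge> 1"
  defines "u \<equiv> a * (1 - a)"
  defines "G \<equiv> fps_one_minus_X_powr a * hyp_fps a v n"
  shows "j < n \<Longrightarrow> of_nat j * (of_nat n - of_nat j) * G $ j =
      (\<Sum>i<j. (v + u * of_nat (j - i)) * G $ i)"
    and "(\<Sum>i<n. (v + u * of_nat (n - i)) * G $ i) =
      hyp_factor a v n (n - 1) * hyp_coeff a v n (n - 1)"
proof -
  define E where "E = fps_one_minus_X_powr a"
  define H where "H = hyp_fps a v n"
  define K where "K = - hyp_factor a v n (n - 1) * hyp_coeff a v n (n - 1)"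
  \<comment> \<open>\<open>T\<close> is theta (n - theta) \<open>G\<close>, since theta^2 = theta +
    x^2 D^2 with D = d/dx.\<close>
  define T where "T = fps_const (of_nat n - 1) * (fps_X * fps_deriv G)
    - fps_X^2 * fps_deriv (fps_deriv G)"
  define W where "W = Abs_fps (\<lambda>k. if k = 0 then 0 else v + u * of_nat k)"
  let ?X = "fps_X :: 'a fps"
  have W: "(1 - ?X)^2 * W = fps_const (u + v) * ?X - fps_const v * ?X^2"
  proof (rule fps_ext)
    fix k
    have "((1 - ?X)^2 * W) $ k = (W - 2 * (?X * W) + ?X^2 * W) $ k"
      by (simp add: power2_eq_square algebra_simps)
    also have "\<dots> = (fps_const (u + v) * ?X - fps_const v * ?X^2) $ k"
      \<comment> \<open>Multiplying by (1 - x)^2 takes second differences, which vanish on affine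
        sequences; only the start of \<open>W\<close> leaves a trace, at x and x^2.\<close>
      by (cases k; cases "k - 1"; cases "k - 2")
        (auto simp: W_def fps_X_power_mult_nth numeral_fps_const algebra_simps)
    finally show "((1 - ?X)^2 * W) $ k = (fps_const (u + v) * ?X - fps_const v * ?X^2) $ k" .
  qed
  have E1: "(1 - ?X) * fps_deriv E = - fps_const a * E"
    unfolding E_def by (rule fps_deriv_one_minus_X_powr)
  have E2: "(1 - ?X) * fps_deriv (fps_deriv E) = (1 - fps_const a) * fps_deriv E"
    using arg_cong[OF E1, of fps_deriv] by (simp add: algebra_simps flip: fps_const_neg)
  have G1: "fps_deriv G = fps_deriv E * H + E * fps_deriv H"
    by (simp add: G_def E_def H_def)
  have G2: "fps_deriv (fps_deriv G) = fps_deriv (fps_deriv E) * H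
    + 2 * fps_deriv E * fps_deriv H + E * fps_deriv (fps_deriv H)"
    by (simp add: G1 algebra_simps)
  have ode: "fps_const (of_nat n - 1) * (?X * fps_deriv H) - ?X^2 * fps_deriv (fps_deriv H)
      + ?X * (fps_const (1 + 2 * a - of_nat n) * (?X * fps_deriv H)
         + ?X^2 * fps_deriv (fps_deriv H) + fps_const (a^2 - of_nat n * a - v) * H)
    = fps_const K * ?X ^ n"
    unfolding H_def K_def using hyp_fps_ode[OF n] .
  \<comment> \<open>Conjugation by (1 - x)^a turns the Fuchsian operator into 1 - x times the
    hypergeometric one; the factor splits off because u = a (1 - a) makes a an exponent at x = 1.
    Here \<open>N\<close> is n - 1, \<open>c\<close> is a, \<open>w\<close> is v, and
    \<open>uv\<close> is the sum u + v. Arbitrary series are used so that \<open>algebra\<close>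
    sees plain variables.\<close>
  have alg: "(1 - x)^2 * (N * (x * (E' * h + e * h')) - x^2 * (E'' * h + 2 * E' * h' + e * h''))
      - (uv * x - w * x^2) * (e * h) = (1 - x) * (e * (k * xn))"
    if "(1 - x) * E' = - c * e" "(1 - x) * E'' = (1 - c) * E'"
      "N * (x * h') - x^2 * h'' + x * ((2 * c - N) * (x * h') + x^2 * h''
       + (c^2 - (N + 1) * c - w) * h) = k * xn"
      "uv = c * (1 - c) + w"
    for uv x N E' E'' e h h' h'' c w k xn :: "'a fps"
    using that by algebra
  have N: "fps_const (1 + 2 * a - of_nat n) = 2 * fps_const a - fps_const (of_nat n - 1)"
    by (simp add: numeral_fps_const algebra_simps)
  have C: "fps_const (a^2 - of_nat n * a - v) =
     (fps_const a)^2 - (fps_const (of_nat n - 1) + 1) * fps_const a - fps_const v"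
    by (simp add: power2_eq_square algebra_simps flip: fps_const_1_eq_1)
  have Uc: "fps_const (u + v) = fps_const a * (1 - fps_const a) + fps_const v"
    by (simp add: u_def algebra_simps flip: fps_const_1_eq_1)
  have GEH: "G = E * H" by (simp add: G_def E_def H_def)
  have "(1 - ?X)^2 * T - ((1 - ?X)^2 * W) * G = (1 - ?X) * (E * (fps_const K * ?X ^ n))"
    unfolding T_def W G2 unfolding G1 unfolding GEH
    by (rule alg[OF E1 E2 ode[unfolded N C] Uc])
  then have "(1 - ?X) * ((1 - ?X) * (T - W * G)) = (1 - ?X) * ((fps_const K * E) * ?X ^ n)"
    by (simp add: power2_eq_square algebra_simps)
  moreover have "1 - ?X \<noteq> 0"
    by (metis fps_X_neq_one right_minus_eq)
  ultimately have "(1 - ?X) * (T - W * G) = (fps_const K * E) * ?X ^ n"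
    by simp
  note * = fps_nth_below_cancel_one_minus_X[OF this]
  have T: "T $ j = of_nat j * (of_nat n - of_nat j) * G $ j" for j
    by (simp add: T_def fps_X_mult_deriv_nth fps_X2_mult_deriv2_nth
        del: fps_mult_fps_X_deriv_shift fps_X_power_mult_nth) (simp add: algebra_simps)
  have WG: "(W * G) $ j = (\<Sum>i<j. (v + u * of_nat (j - i)) * G $ i)" for j
  proof -
    have "(W * G) $ j = (\<Sum>i=0..j. G $ i * W $ (j - i))"
      by (subst mult.commute) (simp add: fps_mult_nth)
    also have "\<dots> = (\<Sum>i<j. G $ i * W $ (j - i))"
      by (rule sum.mono_neutral_right) (auto simp: W_def)
    also have "\<dots> = (\<Sum>i<j. (v + u * of_nat (j - i)) * G $ i)"
      by (rule sum.cong) (auto simp: W_def)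
    finally show ?thesis .
  qed
  show "of_nat j * (of_nat n - of_nat j) * G $ j =
      (\<Sum>i<j. (v + u * of_nat (j - i)) * G $ i)" if "j < n"
    using *(1)[OF that] by (simp add: T WG)
  \<comment> \<open>The constant term of \<open>E\<close> is 1. The factor n - n then kills
    \<open>T $ n\<close>, leaving the defect to \<open>W * G\<close> alone.\<close>
  have "T $ n - (W * G) $ n = K"
    using *(2) by (simp add: E_def fps_one_minus_X_powr_def)
  then show "(\<Sum>i<n. (v + u * of_nat (n - i)) * G $ i) =
      hyp_factor a v n (n - 1) * hyp_coeff a v n (n - 1)"
    unfolding T WG K_def by (simp add: algebra_simps)
qed

section \<open>Closed form of the obstruction\<close>

lemma prod_complement: "(\<Prod>i<k. of_nat (Suc k) - of_nat (Suc i) :: 'a::field_char_0) = fact k"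
proof -
  have "(\<Prod>i<k. of_nat (Suc k) - of_nat (Suc i) :: 'a) = (\<Prod>i<k. of_nat (Suc (k - Suc i)))"
    by (rule prod.cong) (auto simp: of_nat_diff)
  also have "\<dots> = (\<Prod>i<k. of_nat (Suc i))"
    by (rule prod.nat_diff_reindex)
  also have "\<dots> = fact k" by (simp add: fact_prod_Suc atLeast0LessThan)
  finally show ?thesis .
qed

text \<open>The denominators contribute (n - 1)! twice, once ascending and once descending, and the
  extra factor completes the product up to n - 1.\<close>

lemma hyp_coeff_last:
  fixes a v :: "'a::field_char_0"
  assumes "n \<ge> 1"
  shows "(fact n)^2 * (hyp_factor a v n (n - 1) * hyp_coeff a v n (n - 1))
    = (of_nat n)^2 * (\<Prod>i<n. hyp_factor a v n i)"
proof -
  obtain k where k: "n = Suc k" using assms by (cases n) auto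
  have "hyp_coeff a v n k = (\<Prod>i<k. hyp_factor a v n i) / (fact k * fact k)"
    unfolding hyp_coeff_def prod_dividef prod.distrib
    by (simp add: k prod_complement fact_prod_Suc atLeast0LessThan del: of_nat_Suc)
  then show ?thesis
    by (simp add: k power2_eq_square field_simps power_eq_if del: of_nat_Suc)
qed


section \<open>Weighted sums over compositions\<close>

text \<open>The left side is the homogenisation u^l Q(v / u) of Q(X) = prod (X + x), with l the
  length; hence the condition on \<open>u\<close>.\<close>

lemma elem_sym_generating_function:
  fixes u v :: "'a::field"
  assumes "u \<noteq> 0"
  shows "(\<Sum>k=0..length xs. elem_sym k xs * u ^ k * v ^ (length xs - k)) = (\<Prod>x\<leftarrow>xs. v + u * x)"
proof -
  define Q where "Q = (\<Prod>x\<leftarrow>xs. [:x, 1:])"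
  have deg: "degree Q \<le> length xs"
    unfolding Q_def
  proof (induction xs)
    case (Cons x xs)
    have "degree ([:x, 1:] * (\<Prod>x\<leftarrow>xs. [:x, 1:])) \<le> degree [:x, 1:] + degree (\<Prod>x\<leftarrow>xs. [:x, 1:])"
      by (rule degree_mult_le)
    also have "\<dots> \<le> 1 + length xs" using Cons by (intro add_mono) simp_all
    finally show ?case by simp
  qed simp
  have "(\<Sum>k=0..length xs. elem_sym k xs * u ^ k * v ^ (length xs - k)) =
    (\<Sum>k\<le>length xs. coeff Q (length xs - k) * u ^ k * v ^ (length xs - k))"
    by (rule sum.cong) (auto simp: elem_sym_def Q_def)
  also have "\<dots> = (\<Sum>k\<le>length xs. coeff Q k * u ^ (length xs - k) * v ^ k)"
    by (rule sum.reindex_bij_witness[of _ "\<lambda>k. length xs - k" "\<lambda>k. length xs - k"]) auto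
  also have "\<dots> = u ^ length xs * (\<Sum>k\<le>length xs. coeff Q k * (v / u) ^ k)"
    unfolding sum_distrib_left using assms
    by (intro sum.cong) (auto simp: power_diff power_divide)
  also have "(\<Sum>k\<le>length xs. coeff Q k * (v / u) ^ k) = poly Q (v / u)"
    unfolding poly_altdef using deg
    by (intro sum.mono_neutral_right) (auto simp: coeff_eq_0)
  also have "u ^ length xs * poly Q (v / u) = (\<Prod>x\<leftarrow>xs. v + u * x)"
    unfolding Q_def using assms by (induction xs) (simp_all add: field_simps)
  finally show ?thesis .
qed

text \<open>Splits off the last part: \<open>i\<close> is the sum of the others, and
  \<open>i < j\<close> expresses that the last part is positive.\<close>

lemma compositions_Suc:
  "compositions (Suc l) j = (\<Union>i<j. (\<lambda>p. p @ [j - i]) ` compositions l i)"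
proof (intro equalityI subsetI)
  fix p assume p: "p \<in> compositions (Suc l) j"
  then obtain q x where q: "p = q @ [x]"
    by (cases p rule: rev_cases) (auto simp: compositions_def)
  with p have "q \<in> compositions l (sum_list q)" "sum_list q < j" "x = j - sum_list q"
    by (auto simp: compositions_def)
  with q show "p \<in> (\<Union>i<j. (\<lambda>p. p @ [j - i]) ` compositions l i)" by blast
qed (auto simp: compositions_def)

text \<open>The index \<open>i = 0\<close> contributes \<open>w 0\<close>, which is \<open>1\<close> in the application; including it makes the
  recursion on the last part uniform.\<close>
definition step_weight :: "'a::comm_semiring_1 \<Rightarrow> 'a \<Rightarrow> (nat \<Rightarrow> 'a) \<Rightarrow> nat list \<Rightarrow> 'a" where
  "step_weight u v w p =
     (\<Prod>x\<leftarrow>p. v + u * of_nat x) * (\<Prod>i<length p. w (sum_list (take i p)))"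

lemma step_weight_snoc:
  "step_weight u v w (p @ [x]) = (v + u * of_nat x) * w (sum_list p) * step_weight u v w p"
  by (simp add: step_weight_def mult_ac)

lemma sum_step_weight_Suc:
  "(\<Sum>p\<in>compositions (Suc l) j. step_weight u v w p) =
    (\<Sum>i<j. (v + u * of_nat (j - i)) * w i * (\<Sum>p\<in>compositions l i. step_weight u v w p))"
proof -
  have inj: "inj_on (\<lambda>p. p @ [j - i]) (compositions l i)" for i
    by (auto intro: inj_onI)
  have "(\<Sum>p\<in>compositions (Suc l) j. step_weight u v w p) =
    (\<Sum>i<j. \<Sum>p\<in>(\<lambda>p. p @ [j - i]) ` compositions l i. step_weight u v w p)"
    unfolding compositions_Suc
  proof (rule sum.UNION_disjoint)
    show "\<forall>i\<in>{..<j}. \<forall>k\<in>{..<j}. i \<noteq> k \<longrightarrow>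
        (\<lambda>p. p @ [j - i]) ` compositions l i \<inter> (\<lambda>p. p @ [j - k]) ` compositions l k = {}"
      by (auto simp: compositions_def)
  qed (simp_all add: finite_compositions)
  also have "\<dots> = (\<Sum>i<j. (v + u * of_nat (j - i)) * w i *
      (\<Sum>p\<in>compositions l i. step_weight u v w p))"
    unfolding sum_distrib_left
  proof (intro sum.cong[OF refl])
    fix i
    show "(\<Sum>p\<in>(\<lambda>p. p @ [j - i]) ` compositions l i. step_weight u v w p) =
      (\<Sum>p\<in>compositions l i. (v + u * of_nat (j - i)) * w i * step_weight u v w p)"
      unfolding sum.reindex[OF inj]
      by (rule sum.cong) (auto simp: step_weight_snoc compositions_def)
  qed
  finally show ?thesis .
qed

lemma compositions_empty: "j < l \<Longrightarrow> compositions l j = {}"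
proof -
  have "length p \<le> sum_list p" if "\<forall>x\<in>set p. 0 < x" for p :: "nat list"
    using that by (induction p) (auto simp: Suc_le_eq)
  then show "j < l \<Longrightarrow> compositions l j = {}"
    by (fastforce simp: compositions_def)
qed

text \<open>The f_j of the recursion. Starting at l = 0 lets the empty composition supply f_0 = 1;
  for positive \<open>j\<close> that term is an empty sum.\<close>

definition total_weight :: "'a::comm_semiring_1 \<Rightarrow> 'a \<Rightarrow> (nat \<Rightarrow> 'a) \<Rightarrow> nat \<Rightarrow> 'a" where
  "total_weight u v w j = (\<Sum>l\<le>j. \<Sum>p\<in>compositions l j. step_weight u v w p)"

lemma total_weight_0: "total_weight u v w 0 = 1"
proof -
  have "compositions 0 0 = {[]}" by (auto simp: compositions_def)
  then show ?thesis by (simp add: total_weight_def step_weight_def)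
qed

lemma total_weight_pos:
  assumes "j > 0"
  shows "total_weight u v w j = (\<Sum>l=1..j. \<Sum>p\<in>compositions l j. step_weight u v w p)"
    and "total_weight u v w j = (\<Sum>i<j. (v + u * of_nat (j - i)) * (w i * total_weight u v w i))"
proof -
  have 0: "compositions 0 j = {}" using assms by (auto simp: compositions_def)
  show *: "total_weight u v w j = (\<Sum>l=1..j. \<Sum>p\<in>compositions l j. step_weight u v w p)"
    unfolding total_weight_def
    by (rule sum.mono_neutral_right) (auto simp: 0 not_less_eq_eq)
  also have "\<dots> = (\<Sum>l<j. \<Sum>p\<in>compositions (Suc l) j. step_weight u v w p)"
    by (rule sum.reindex_bij_witness[of _ Suc "\<lambda>l. l - 1"]) auto
  also have "\<dots> = (\<Sum>i<j. \<Sum>l<j. (v + u * of_nat (j - i)) * w i *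
      (\<Sum>p\<in>compositions l i. step_weight u v w p))"
    unfolding sum_step_weight_Suc by (rule sum.swap)
  also have "\<dots> = (\<Sum>i<j. (v + u * of_nat (j - i)) * (w i * total_weight u v w i))"
  proof (intro sum.cong refl)
    fix i assume "i \<in> {..<j}"
    \<comment> \<open>A composition of \<open>i\<close> has at most \<open>i\<close> parts, so the
      common range \<open>l < j\<close> shrinks to the one defining the weight at
      \<open>i\<close>.\<close>
    then have "(\<Sum>l<j. \<Sum>p\<in>compositions l i. step_weight u v w p) = total_weight u v w i"
      unfolding total_weight_def
      by (intro sum.mono_neutral_right) (auto simp: compositions_empty)
    then show "(\<Sum>l<j. (v + u * of_nat (j - i)) * w i *
        (\<Sum>p\<in>compositions l i. step_weight u v w p)) =
      (v + u * of_nat (j - i)) * (w i * total_weight u v w i)"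
      by (simp add: mult.assoc flip: sum_distrib_left)
  qed
  finally show "total_weight u v w j =
    (\<Sum>i<j. (v + u * of_nat (j - i)) * (w i * total_weight u v w i))" .
qed

section \<open>The weights 1/q_i and evaluation of P_n\<close>

text \<open>The value at 0 is set to 1 because \<open>step_weight\<close> always includes the empty
  prefix; 1/0 = 0 would annihilate every nonempty composition.\<close>

definition cut_weight :: "nat \<Rightarrow> nat \<Rightarrow> 'a::field_char_0" where
  "cut_weight n i = (if i = 0 then 1 else 1 / (of_nat i * (of_nat n - of_nat i)))"

lemma total_weight_cut_weight:
  fixes a v :: "'a::field_char_0"
  assumes n: "n \<ge> 1"
  shows "total_weight (a * (1 - a)) v (cut_weight n) n =
    hyp_factor a v n (n - 1) * hyp_coeff a v n (n - 1)"
proof -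
  define u where "u = a * (1 - a)"
  define G where "G = fps_one_minus_X_powr a * hyp_fps a v n"
  note rec = hyp_recurrence[OF n, where a = a and v = v, folded u_def G_def]
  \<comment> \<open>Both sides satisfy the same recurrence below \<open>n\<close> and start with
    1.\<close>
  have G: "cut_weight n j * total_weight u v (cut_weight n) j = G $ j" if "j < n" for j
    using that
  proof (induction j rule: less_induct)
    case (less j)
    show ?case
    proof (cases "j = 0")
      case True
      then show ?thesis using n
        by (simp add: cut_weight_def total_weight_0 G_def fps_one_minus_X_powr_def hyp_fps_def
            hyp_coeff_def)
    next
      case False
      have "total_weight u v (cut_weight n) j = (\<Sum>i<j. (v + u * of_nat (j - i)) * G $ i)"
        unfolding total_weight_pos(2)[OF False[unfolded neq0_conv]]
        using less by (intro sum.cong) auto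
      also have "\<dots> = of_nat j * (of_nat n - of_nat j) * G $ j"
        using rec(1)[OF less.prems] by simp
      finally have "total_weight u v (cut_weight n) j = of_nat j * (of_nat n - of_nat j) * G $ j" .
      moreover have "of_nat j \<noteq> (0::'a)" "of_nat n - of_nat j \<noteq> (0::'a)"
        using False less.prems by auto
      ultimately show ?thesis
        by (simp add: cut_weight_def[of n j])
    qed
  qed
  have "total_weight u v (cut_weight n) n = (\<Sum>i<n. (v + u * of_nat (n - i)) * G $ i)"
    using n by (subst total_weight_pos(2)) (auto simp: G)
  then show ?thesis using rec(2) by (simp add: u_def)
qed

text \<open>Prefix and suffix sums at the same cut add up to \<open>n\<close>, so pairing them gives
  q at that partial sum; the two full sums give n^2.\<close>

lemma cut_weight_prod:
  assumes "p \<in> compositions l n" "l \<ge> 1"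
  shows "(of_nat (prefix_prod p) * of_nat (suffix_prod p) :: 'a::field_char_0) =
    of_nat n ^ 2 / (\<Prod>i<length p. cut_weight n (sum_list (take i p)))"
proof -
  have p: "length p = l" "\<forall>x\<in>set p. 0 < x" "sum_list p = n"
    using assms by (auto simp: compositions_def)
  have "(\<Prod>i<length p. cut_weight n (sum_list (take i p)) :: 'a) =
    (\<Prod>i=1..<length p. cut_weight n (sum_list (take i p)))"
    by (rule prod.mono_neutral_right) (auto simp: cut_weight_def not_less_eq_eq)
  also have "\<dots> = (\<Prod>i=1..<length p.
      1 / (of_nat (sum_list (take i p)) * of_nat (sum_list (drop i p))))"
  proof (intro prod.cong refl)
    fix i assume i: "i \<in> {1..<length p}"
    have "sum_list (take i p) + sum_list (drop i p) = n"
      using p(3) by (metis append_take_drop_id sum_list_append)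
    then have d: "of_nat n - of_nat (sum_list (take i p)) = (of_nat (sum_list (drop i p)) :: 'a)"
      by (metis add_diff_cancel_left' of_nat_add)
    have "sum_list (take i p) \<noteq> 0"
      using i p(2) by (cases p; cases i) auto
    then show "cut_weight n (sum_list (take i p)) =
        (1 / (of_nat (sum_list (take i p)) * of_nat (sum_list (drop i p))) :: 'a)"
      by (simp add: cut_weight_def d)
  qed
  finally show ?thesis
    by (simp add: prefix_prod_def suffix_prod_def p prod_dividef prod.distrib power2_eq_square mult_ac)
qed

text \<open>The outer indeterminate is evaluated at the constant polynomial \<open>[:u:]\<close>,
  the inner one at \<open>v\<close>. The sum over \<open>k\<close> then collapses to a product over
  the parts.\<close>

lemma eval_P_poly:
  assumes "n \<ge> 1" "u \<noteq> 0"
  shows "of_nat n ^ 2 * poly (poly (P_poly n) [:u:]) v = total_weight u v (cut_weight n) n"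
proof -
  have "poly (poly (P_poly n) [:u:]) v =
    (\<Sum>l=1..n. \<Sum>k=0..l. S_coeff k l n * u ^ k * v ^ (l - k))"
    by (simp add: P_poly_def poly_sum U_def V_def mult.assoc)
  also have "of_nat n ^ 2 * \<dots> = (\<Sum>l=1..n. \<Sum>p\<in>compositions l n. step_weight u v (cut_weight n) p)"
    unfolding sum_distrib_left[of _ _ "{1..n}"]
  proof (intro sum.cong refl)
    fix l assume l: "l \<in> {1..n}"
    have "(\<Sum>k=0..l. S_coeff k l n * u ^ k * v ^ (l - k)) =
      (\<Sum>p\<in>compositions l n. \<Sum>k=0..l. elem_sym k (map of_nat p) * u ^ k * v ^ (l - k)
         / (of_nat (prefix_prod p) * of_nat (suffix_prod p)))"
      unfolding S_coeff_def sum_distrib_right by (subst sum.swap) simp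
    also have "of_nat n ^ 2 * \<dots> = (\<Sum>p\<in>compositions l n. step_weight u v (cut_weight n) p)"
      unfolding sum_distrib_left[of _ _ "compositions l n"]
    proof (intro sum.cong refl)
      fix p assume p: "p \<in> compositions l n"
      then have len: "l = length (map of_nat p :: rat list)" by (simp add: compositions_def)
      have "(\<Sum>k=0..l. elem_sym k (map of_nat p) * u ^ k * v ^ (l - k)) =
        (\<Prod>x\<leftarrow>p. v + u * of_nat x)"
        using elem_sym_generating_function[OF assms(2), of "map of_nat p" v] 
        unfolding len[symmetric] by (simp add: o_def)
      then show "of_nat n ^ 2 * (\<Sum>k=0..l. elem_sym k (map of_nat p) * u ^ k * v ^ (l - k)
         / (of_nat (prefix_prod p) * of_nat (suffix_prod p))) = step_weight u v (cut_weight n) p"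
        using l assms(1) unfolding sum_divide_distrib[symmetric]
        by (subst cut_weight_prod[OF p]) (auto simp: step_weight_def)
    qed
    finally show "of_nat n ^ 2 * (\<Sum>k=0..l. S_coeff k l n * u ^ k * v ^ (l - k)) =
      (\<Sum>p\<in>compositions l n. step_weight u v (cut_weight n) p)" .
  qed
  also have "\<dots> = total_weight u v (cut_weight n) n"
    using assms(1) by (simp add: total_weight_pos(1))
  finally show ?thesis .
qed

text \<open>The excluded values of \<open>a\<close> are those with a (1 - a) = 0, where the
  homogenisation argument would divide by zero.\<close>

lemma eval_P_poly_product:
  assumes "n \<ge> 1" "a \<noteq> 0" "a \<noteq> 1"
  shows "(fact n)^2 * poly (poly (P_poly n) [:a * (1 - a):]) v = (\<Prod>i<n. hyp_factor a v n i)"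
proof -
  have "(of_nat n :: rat) ^ 2 * ((fact n)^2 * poly (poly (P_poly n) [:a * (1 - a):]) v) =
     of_nat n ^ 2 * (\<Prod>i<n. hyp_factor a v n i)"
    using eval_P_poly[of n "a * (1 - a)" v] total_weight_cut_weight[of n a v]
      hyp_coeff_last[of n a v] assms by (simp add: mult.left_commute)
  then show ?thesis using assms by simp
qed

section \<open>Pairing the factors and identifying the polynomials\<close>

text \<open>Put u = a (1 - a), s = n - 1 - 2 i, A = u + v + q_i and B = u + v + q_(i+1). The factors
  are A + a s and B - a s, and B - A = s, so the product is A B + a s^2 - a^2 s^2 = A B + u
  r_i.\<close>

lemma hyp_factor_reflect:
  assumes "i < n"
  shows "hyp_factor a v n i * hyp_factor a v n (n - 1 - i) =
    (a * (1 - a) + v + of_int (q_num n i)) * (a * (1 - a) + v + of_int (q_num n (i + 1)))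
      + a * (1 - a) * of_int (r_num n i)"
proof -
  have "of_nat (n - 1 - i) = (of_nat n - 1 - of_nat i :: 'a)"
    using assms by (simp add: of_nat_diff)
  then show ?thesis
    unfolding hyp_factor_def q_num_def r_num_def of_int_mult of_int_diff of_int_add of_int_power
      of_int_of_nat_eq of_nat_add of_nat_1 of_int_1 of_int_numeral
    by algebra
qed

lemma prod_lessThan_reflect:
  fixes f :: "nat \<Rightarrow> 'a::comm_monoid_mult"
  shows "(\<Prod>i<2 * m. f i) = (\<Prod>i=0..<m. f i * f (2 * m - 1 - i))"
    and "(\<Prod>i<2 * m + 1. f i) = f m * (\<Prod>i=0..<m. f i * f (2 * m - i))"
proof -
  have r: "(\<Prod>i\<in>{k..<k+m}. f i) = (\<Prod>i=0..<m. f (k + m - 1 - i))" for k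
    by (rule prod.reindex_bij_witness[of _ "\<lambda>i. k + m - 1 - i" "\<lambda>i. k + m - 1 - i"]) auto
  have "{..<2 * m} = {0..<m} \<union> {m..<m + m}" by auto
  then show "(\<Prod>i<2 * m. f i) = (\<Prod>i=0..<m. f i * f (2 * m - 1 - i))"
    by (simp add: prod.union_disjoint r prod.distrib mult_2)
  have "{..<2 * m + 1} = insert m ({0..<m} \<union> {Suc m..<Suc m + m})" by auto
  then show "(\<Prod>i<2 * m + 1. f i) = f m * (\<Prod>i=0..<m. f i * f (2 * m - i))"
    using r[of "Suc m"] by (simp add: prod.union_disjoint prod.distrib mult_2)
qed

text \<open>Agreement for all \<open>v\<close> makes each constant polynomial a (1 - a) a root of
  \<open>P - Q\<close> over the domain Q[v]; infinitely many roots force zero.\<close>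

lemma rat_poly_poly_eqI:
  fixes P Q :: "rat poly poly"
  assumes "\<And>a v. a \<noteq> 0 \<Longrightarrow> a \<noteq> 1 \<Longrightarrow>
    poly (poly P [:a * (1 - a):]) v = poly (poly Q [:a * (1 - a):]) v"
  shows "P = Q"
proof -
  have root: "poly (P - Q) [:a * (1 - a):] = 0" if "a \<noteq> 0" "a \<noteq> 1" for a
    using assms[OF that] by (simp flip: poly_eq_poly_eq_iff) (simp add: fun_eq_iff)
  \<comment> \<open>The shift by 2 avoids a = 0 and a = 1. As a and 1 - a give the same value,
    keeping a above 1/2 makes the values distinct.\<close>
  define h :: "nat \<Rightarrow> rat poly" where "h = (\<lambda>k. [:of_nat (k + 2) * (1 - of_nat (k + 2)):])"
  have "poly (P - Q) (h k) = 0" for k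
    unfolding h_def by (rule root) (simp_all only: of_nat_eq_0_iff of_nat_eq_1_iff)
  then have "range h \<subseteq> {x. poly (P - Q) x = 0}"
    by auto
  moreover have "inj h"
  proof (rule injI)
    fix x y :: nat
    assume "h x = h y"
    then have "(of_nat x - of_nat y) * (of_nat x + of_nat y + 3) = (0::rat)"
      by (simp add: h_def algebra_simps)
    moreover have "(of_nat x + of_nat y + 3 :: rat) > 0" by linarith
    ultimately show "x = y" by simp
  qed
  ultimately have "infinite {x. poly (P - Q) x = 0}"
    by (metis finite_subset range_inj_infinite)
  then show "P = Q"
    using poly_roots_finite[of "P - Q"] by auto
qed

lemma poly_fact_eq: "poly (fact k) x = fact k"
  by (metis of_nat_fact poly_of_nat)

theorem theorem1:
  fixes n :: nat
  assumes "n \<ge> 1"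
  shows "(\<forall>m. n = 2 * m \<longrightarrow>
           (fact n)\<^sup>2 * P_poly n =
             (\<Prod>i=0..<m. (U + V + of_int (q_num n i)) * (U + V + of_int (q_num n (i + 1)))
                          + of_int (r_num n i) * U)) \<and>
         (\<forall>m. n = 2 * m + 1 \<longrightarrow>
           (fact n)\<^sup>2 * P_poly n =
             (U + V + of_int (q_num n m)) *
             (\<Prod>i=0..<m. (U + V + of_int (q_num n i)) * (U + V + of_int (q_num n (i + 1)))
                          + of_int (r_num n i) * U))"
proof (intro conjI allI impI)
  fix m assume m: "n = 2 * m"
  show "(fact n)\<^sup>2 * P_poly n =
    (\<Prod>i=0..<m. (U + V + of_int (q_num n i)) * (U + V + of_int (q_num n (i + 1)))
                          + of_int (r_num n i) * U)"
  proof (rule rat_poly_poly_eqI)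
    fix a v :: rat assume a: "a \<noteq> 0" "a \<noteq> 1"
    have "(\<Prod>i<n. hyp_factor a v n i) =
      (\<Prod>i=0..<m. hyp_factor a v n i * hyp_factor a v n (n - 1 - i))"
      unfolding m by (rule prod_lessThan_reflect)
    also have "\<dots> = (\<Prod>i=0..<m. (a * (1 - a) + v + of_int (q_num n i)) *
        (a * (1 - a) + v + of_int (q_num n (i + 1))) + a * (1 - a) * of_int (r_num n i))"
      using m by (intro prod.cong refl hyp_factor_reflect) auto
    finally show "poly (poly ((fact n)\<^sup>2 * P_poly n) [:a * (1 - a):]) v =
      poly (poly (\<Prod>i=0..<m. (U + V + of_int (q_num n i)) * (U + V + of_int (q_num n (i + 1)))
        + of_int (r_num n i) * U) [:a * (1 - a):]) v"
      using eval_P_poly_product[OF assms a, of v]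
      by (simp add: poly_prod poly_fact_eq U_def V_def)
  qed
next
  fix m assume m: "n = 2 * m + 1"
  show "(fact n)\<^sup>2 * P_poly n = (U + V + of_int (q_num n m)) *
    (\<Prod>i=0..<m. (U + V + of_int (q_num n i)) * (U + V + of_int (q_num n (i + 1)))
                          + of_int (r_num n i) * U)"
  proof (rule rat_poly_poly_eqI)
    fix a v :: rat assume a: "a \<noteq> 0" "a \<noteq> 1"
    \<comment> \<open>The index m is fixed by i -> n - 1 - i; there s = 0, so the single factor
      already depends on a (1 - a) only.\<close>
    have mid: "hyp_factor a v n m = a * (1 - a) + v + of_int (q_num n m)"
      by (simp add: hyp_factor_def q_num_def m algebra_simps)
    have "(\<Prod>i<n. hyp_factor a v n i) = hyp_factor a v n m *
      (\<Prod>i=0..<m. hyp_factor a v n i * hyp_factor a v n (n - 1 - i))"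
      unfolding m by (subst prod_lessThan_reflect) simp
    also have "(\<Prod>i=0..<m. hyp_factor a v n i * hyp_factor a v n (n - 1 - i)) =
      (\<Prod>i=0..<m. (a * (1 - a) + v + of_int (q_num n i)) *
        (a * (1 - a) + v + of_int (q_num n (i + 1))) + a * (1 - a) * of_int (r_num n i))"
      using m by (intro prod.cong refl hyp_factor_reflect) auto
    finally show "poly (poly ((fact n)\<^sup>2 * P_poly n) [:a * (1 - a):]) v =
      poly (poly ((U + V + of_int (q_num n m)) *
        (\<Prod>i=0..<m. (U + V + of_int (q_num n i)) * (U + V + of_int (q_num n (i + 1)))
        + of_int (r_num n i) * U)) [:a * (1 - a):]) v"
      using eval_P_poly_product[OF assms a, of v]
      by (simp add: mid poly_prod poly_fact_eq U_def V_def)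
  qed
qed

end
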